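(* For all integers $d$ and $m$ with $0 < d < 10$ and $m \geq 0$, the number $f(d,m,231)$ is composite.
   Context: For an integer $k \ge 0$ let $R(k) = \frac{10^k-1}{9}$ (the repunit, written in decimal with $k$ ones; $R(0)=0$). For a digit $d$, an integer $m \ge 0$ and a positive integer $n$ with exactly $t$ decimal digits, define $f(d,m,n) = dR(m)10^{t+m} + n10^m + dR(m)$; that is, $f(d,m,n)$ is the number whose decimal representation is obtained by writing the digit $d$ exactly $m$ times in front of $n$ and $m$ times after $n$ (e.g. $f(2,3,45) = 22245222$, and $f(d,0,n)=n$). *)

theory Defs
  imports Complex_Main "HOL-Library.Log_Nat" "HOL-Computational_Algebra.Primes"
begin

(* The division is exact, since 9 divides 10 ^ k - 1. *)
definition repunit :: "nat \<Rightarrow> nat" where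
  "repunit k = (10 ^ k - 1) div 9"

(* For n > 0, floorlog 10 n is the number of decimal digits of n. *)
definition f :: "nat \<Rightarrow> nat \<Rightarrow> nat \<Rightarrow> nat" where
  "f d m n = d * repunit m * 10 ^ (floorlog 10 n + m) + n * 10 ^ m + d * repunit m"

definition composite :: "nat \<Rightarrow> bool" where
  "composite n \<longleftrightarrow> 1 < n \<and> \<not> prime n"

lemma "f 2 3 45 = 22245222"
  by (simp add: f_def repunit_def compute_floorlog)

lemma "f d 0 n = n"
  by (simp add: f_def repunit_def)

end

theory Submission
  imports Defs "HOL-Number_Theory.Cong"
begin

text \<open>
  Each of the numbers has a prime factor from $\{2, 3, 5, 7, 11, 13\}$, which is proper because
  the numbers are at least $231 = 3 \cdot 7 \cdot 11$.

  A prime dividing both the outer digit $d$ and the middle block $231 \cdot 10^m$ divides the whole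
  number. This settles every $d \neq 1$: the digits $3, 6, 9$ share the factor $3$ with $231$, the
  digit $7$ the factor $7$, and $2, 4, 8, 5$ share a factor with $10^m$ as soon as
  $m > 0$; for $m = 0$ the number is $231$ itself.

  For $d = 1$ there is a covering of the exponents. As $10^m = 9 R(m) + 1$, the number is a
  quadratic polynomial in the repunit $R(m)$, and the repunit $R(6) = 111111$ is divisible by $3$,
  $11$ and $13$, so modulo these primes everything depends on $m$ modulo $6$ only. It turns out that
  $11$ divides the number for even $m$, that $3$ divides it for $m \equiv 3$, and that $13$ divides
  it for $m \equiv 1, 5 \pmod 6$.
\<close>

lemma power_10_eq_repunit: "10 ^ m = 9 * repunit m + 1"
proof -
  have "9 dvd (10 ^ m - 1 :: nat)"
    using cong_pow[of "10 :: nat" 1 9 m] mod_eq_dvd_iff_nat[of 1 "10 ^ m" 9]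
    by (simp add: cong_def)
  then have "9 * repunit m = 10 ^ m - 1"
    by (simp add: repunit_def)
  then show ?thesis
    by simp
qed

lemma repunit_add: "repunit (a + b) = repunit a * 10 ^ b + repunit b"
  using power_10_eq_repunit[of "a + b"]
  by (simp add: power_add power_10_eq_repunit algebra_simps)

text \<open>A modulus dividing $R(a)$ divides $10^a - 1$, so it sees powers of $10$, and with them
  repunits, with period $a$.\<close>

lemma repunit_cong_mod_index:
  assumes "q dvd repunit a"
  shows "[repunit m = repunit (m mod a)] (mod q)"
proof -
  have "[repunit (a * k + b) = repunit b] (mod q)" for k b
  proof (induction k)
    case (Suc k)
    have "[repunit a * 10 ^ (a * k + b) + repunit (a * k + b) = 0 + repunit b] (mod q)"
      using assms Suc by (intro cong_add) (simp_all add: cong_0_iff)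
    then show ?case
      by (simp add: repunit_add[symmetric] add.assoc)
  qed simp
  from this[of "m div a" "m mod a"] show ?thesis
    by simp
qed

lemma f_231_eq:
  "f d m 231 = d * repunit m * (1000 * 10 ^ m + 1) + 231 * 10 ^ m"
  by (simp add: f_def compute_floorlog power_add algebra_simps)

lemma f_231_eq_repunit_poly:
  "f d m 231 = 9000 * d * repunit m ^ 2 + (1001 * d + 2079) * repunit m + 231"
  by (simp add: f_231_eq power_10_eq_repunit power2_eq_square algebra_simps)

lemma composite_f_231I:
  assumes "p dvd f d m 231" and "1 < p" and "p < 231"
  shows "composite (f d m 231)"
proof -
  have "231 \<le> f d m 231"
    by (simp add: f_231_eq_repunit_poly)
  with assms show ?thesis
    by (auto simp: composite_def prime_nat_iff)
qed

lemma dvd_f_231_if_dvd_digit: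
  assumes "p dvd d" and "p dvd 231 * 10 ^ m"
  shows "p dvd f d m 231"
  using assms by (simp add: f_231_eq)

lemma f_1_231_has_small_factor:
  obtains p where "p \<in> {3, 11, 13}" and "p dvd f 1 m 231"
proof -
  let ?r = "m mod 6"
  have residue: "p dvd f 1 m 231 \<longleftrightarrow> p dvd f 1 ?r 231" if "p \<in> {3, 11, 13}" for p
  proof -
    have "p dvd repunit 6"
      using that by (auto simp: repunit_def)
    then have "[repunit m = repunit ?r] (mod p)"
      by (rule repunit_cong_mod_index)
    then have "[f 1 m 231 = f 1 ?r 231] (mod p)"
      unfolding f_231_eq_repunit_poly by (intro cong_add cong_mult cong_pow) simp_all
    then show ?thesis
      by (rule cong_dvd_iff)
  qed
  have "?r \<in> {0, 1, 2, 3, 4, 5}"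
    by auto
  then have "11 dvd f 1 ?r 231 \<or> 3 dvd f 1 ?r 231 \<or> 13 dvd f 1 ?r 231"
    by (auto simp: f_231_eq repunit_def)
  with residue that show thesis
    by blast
qed

theorem theorem1:
  fixes d m :: nat
  assumes "0 < d" and "d < 10"
  shows "composite (f d m 231)"
proof (cases "d = 1")
  case True
  obtain p where "p \<in> {3, 11, 13}" and "p dvd f 1 m 231"
    by (rule f_1_231_has_small_factor)
  with True show ?thesis
    by (intro composite_f_231I[of p]) auto
next
  case False
  have "\<exists>p \<in> {2, 3, 5, 7}. p dvd f d m 231"
  proof (cases "m = 0")
    case True
    then show ?thesis
      by (simp add: f_231_eq repunit_def)
  next
    case m_pos: False
    have "d \<in> {3, 6, 9} \<or> d = 7 \<or> d \<in> {2, 4, 8} \<or> d = 5"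
      using assms False by auto
    then have "3 dvd d \<or> 7 dvd d \<or> 2 dvd d \<or> 5 dvd d"
      by auto
    moreover have "3 dvd 231 * (10 :: nat) ^ m" and "7 dvd 231 * (10 :: nat) ^ m"
      by (simp_all add: dvd_mult2)
    moreover have "2 dvd 231 * (10 :: nat) ^ m" and "5 dvd 231 * (10 :: nat) ^ m"
      using m_pos by (cases m; simp)+
    ultimately show ?thesis
      using dvd_f_231_if_dvd_digit by blast
  qed
  then show ?thesis
    by (auto intro: composite_f_231I)
qed

end
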